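(* Let $p\in\mathbb{N}_0$, $r\in\mathbb{N}$ and $k_1,\dots,k_r\in\mathbb{N}$. For $0\le i\le r$ put $K_i=k_1+\dots+k_i$ (so $K_0=0$). For nonnegative integers $j_1,j_2,\dots$ put $J_i=j_1+\dots+j_i$ ($J_0=0$) and $q_i=p+i-K_i-J_i$ (so $q_0=p$), and for $m\ge1$ set $$c(j_1,\dots,j_m)=\prod_{h=0}^{m-1}\frac{\binom{q_h+1}{j_{h+1}}B_{j_{h+1}}}{q_h+1}.$$ For $1\le l\le r$ let $\mathcal{A}_l$ be the set of $(j_1,\dots,j_l)\in\mathbb{N}_0^l$ with $j_i\le q_{i-1}+1-k_i$ for $1\le i\le l-1$ and $j_l\le q_{l-1}$; let $\mathcal{B}_l$ be the set of $(j_1,\dots,j_l)\in\mathbb{N}_0^l$ with $j_i\le q_{i-1}+1-k_i$ for $1\le i\le l-1$ and $q_{l-1}+2-k_l\le j_l\le q_{l-1}$; and let $\mathcal{C}$ be the set of $(j_1,\dots,j_{r+1})\in\mathbb{N}_0^{r+1}$ with $j_i\le q_{i-1}+1-k_i$ for $1\le i\le r$ and $j_{r+1}\le q_r$. Then for every $n\in\mathbb{N}$, \begin{align*} H_n(-p,k_1,\dots,k_r)=&\sum_{l=1}^r(-1)^{l-1}\sum_{(j_1,\dots,j_l)\in\mathcal{A}_l}c(j_1,\dots,j_l)\,n^{q_{l-1}+1-j_l}\,H_n(k_l,\dots,k_r)\\ &+\sum_{l=1}^r(-1)^{l}\sum_{(j_1,\dots,j_l)\in\mathcal{B}_l}c(j_1,\dots,j_l)\,H_n(-q_l,k_{l+1},\dots,k_r)\\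 &+(-1)^r\sum_{(j_1,\dots,j_{r+1})\in\mathcal{C}}c(j_1,\dots,j_{r+1})\,n^{q_r+1-j_{r+1}}. \end{align*} (Here, in the second sum $-q_l=K_l+J_l-l-p\ge1$, and all denominators $q_h+1$ occurring are positive.)
   Context: For $n\in\mathbb{N}$ and $(k_1,\dots,k_r)\in\mathbb{Z}^r$ the extended multiple harmonic sum is $H_n(k_1,\dots,k_r)=\sum_{n\ge n_1>\dots>n_r>0}n_1^{-k_1}\cdots n_r^{-k_r}$, with $H_n(\emptyset)=1$ and $H_n(k_1,\dots,k_r)=0$ if $n<r$. In particular $H_n(-p,k_1,\dots,k_r)=\sum_{m=1}^n m^pH_{m-1}(k_1,\dots,k_r)$. The Bernoulli numbers $B_j$ are defined by $\frac{te^t}{e^t-1}=\sum_{j\ge0}B_j\frac{t^j}{j!}$ (so $B_1=1/2$). Empty sums are $0$. *)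

theory Defs
  imports Complex_Main "HOL-Computational_Algebra.Formal_Power_Series"
begin

text \<open>
  A composition \<open>(k\<^sub>1, \<dots>, k\<^sub>r)\<close> is a list \<open>ks\<close> of length \<open>r\<close> and a tuple \<open>(j\<^sub>1, \<dots>, j\<^sub>m)\<close> a list
  \<open>js\<close>, so \<open>k\<^sub>i\<close> is \<open>ks ! (i - 1)\<close> and \<open>(k\<^sub>l, \<dots>, k\<^sub>r)\<close> is \<open>drop (l - 1) ks\<close>.
\<close>

definition decr_tuples :: "nat \<Rightarrow> nat \<Rightarrow> nat list set" where
  "decr_tuples n r = {ns. length ns = r \<and> sorted_wrt (>) ns \<and> set ns \<subseteq> {1..n}}"

definition mult_harm :: "nat \<Rightarrow> int list \<Rightarrow> real" where
  "mult_harm n ks =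
     (\<Sum>ns\<in>decr_tuples n (length ks). \<Prod>i<length ks. real (ns ! i) powi (- (ks ! i)))"

lemma finite_decr_tuples: "finite (decr_tuples n r)"
proof -
  have "decr_tuples n r \<subseteq> {ns. set ns \<subseteq> {1..n} \<and> length ns = r}"
    by (auto simp: decr_tuples_def)
  then show ?thesis
    using finite_lists_length_eq[of "{1..n}" r] finite_subset by blast
qed

lemma mult_harm_Nil: "mult_harm n [] = 1"
proof -
  have "decr_tuples n 0 = {[]}"
    by (auto simp: decr_tuples_def)
  then show ?thesis
    by (simp add: mult_harm_def)
qed

lemma mult_harm_eq_0:
  assumes "n < length ks"
  shows "mult_harm n ks = 0"
proof -
  have "ns \<notin> decr_tuples n (length ks)" for ns
  proof
    assume ns: "ns \<in> decr_tuples n (length ks)"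
    then have "distinct ns"
      unfolding decr_tuples_def
      by (auto simp: distinct_conv_nth sorted_wrt_iff_nth_less)
         (metis less_irrefl linorder_neqE_nat)
    then have "length ns = card (set ns)"
      by (simp add: distinct_card)
    also have "\<dots> \<le> card {1..n}"
      using ns by (intro card_mono) (auto simp: decr_tuples_def)
    finally show False
      using ns assms by (simp add: decr_tuples_def)
  qed
  then have "decr_tuples n (length ks) = {}"
    by blast
  then show ?thesis
    by (simp add: mult_harm_def)
qed

text \<open>
  Bernoulli numbers with \<open>B\<^sub>1 = 1/2\<close>, read off from \<open>t e\<^sup>t / (e\<^sup>t - 1)\<close>. The quotient is taken in
  formal power series over a field, where division first cancels the common factor \<open>t\<close>.
\<close>

definition bern :: "nat \<Rightarrow> real" where
  "bern j = fact j * fps_nth (fps_X * fps_exp 1 / (fps_exp 1 - 1)) j"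

lemma bern_egf:
  "Abs_fps (\<lambda>j. bern j / fact j) * (fps_exp 1 - 1) = fps_X * fps_exp (1 :: real)"
proof -
  let ?d = "fps_exp 1 - 1 :: real fps"
  have d1: "fps_nth ?d 1 \<noteq> 0"
    by simp
  have nz: "?d \<noteq> 0"
    using d1 by (metis fps_zero_nth)
  have "subdegree ?d = 1"
    using d1 by (intro subdegreeI) auto
  moreover have "subdegree (fps_X * fps_exp (1 :: real)) = 1"
    by (intro subdegreeI) auto
  ultimately have "?d dvd fps_X * fps_exp 1"
    using nz by (subst fps_dvd_iff) auto
  moreover have "Abs_fps (\<lambda>j. bern j / fact j) = fps_X * fps_exp 1 / ?d"
    by (rule fps_ext) (simp add: bern_def)
  ultimately show ?thesis
    by (simp add: dvd_div_mult_self)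
qed

lemma bern_0: "bern 0 = 1"
  using arg_cong[OF bern_egf, of "\<lambda>f. fps_nth f 1"]
  by (simp add: fps_mult_nth numeral_2_eq_2)

lemma bern_1: "bern 1 = 1 / 2"
  using arg_cong[OF bern_egf, of "\<lambda>f. fps_nth f 2"] bern_0
  by (simp add: fps_mult_nth numeral_2_eq_2)

text \<open>
  The numbers \<open>q\<^sub>i = p + i - K\<^sub>i - J\<^sub>i\<close> depend on \<open>ks\<close> and \<open>js\<close> only through their first \<open>i\<close>
  entries, and may be negative.
\<close>

definition q_idx :: "nat \<Rightarrow> nat list \<Rightarrow> nat list \<Rightarrow> nat \<Rightarrow> int" where
  "q_idx p ks js i = int p + int i - int (sum_list (take i ks)) - int (sum_list (take i js))"

definition c_coeff :: "nat \<Rightarrow> nat list \<Rightarrow> nat list \<Rightarrow> real" where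
  "c_coeff p ks js =
     (\<Prod>h<length js. (of_int (q_idx p ks js h + 1) gchoose (js ! h)) * bern (js ! h)
                        / of_int (q_idx p ks js h + 1))"

text \<open>The bounds \<open>j\<^sub>i \<le> q\<^bsub>i-1\<^esub> + 1 - k\<^sub>i\<close> for \<open>1 \<le> i \<le> m\<close>, common to all three index sets.\<close>

definition bounded_upto :: "nat \<Rightarrow> nat list \<Rightarrow> nat list \<Rightarrow> nat \<Rightarrow> bool" where
  "bounded_upto p ks js m \<longleftrightarrow>
     (\<forall>i\<in>{1..m}. int (js ! (i - 1)) \<le> q_idx p ks js (i - 1) + 1 - int (ks ! (i - 1)))"

definition A_set :: "nat \<Rightarrow> nat list \<Rightarrow> nat \<Rightarrow> nat list set" where
  "A_set p ks l = {js. length js = l \<and> bounded_upto p ks js (l - 1) \<and>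
                       int (js ! (l - 1)) \<le> q_idx p ks js (l - 1)}"

definition B_set :: "nat \<Rightarrow> nat list \<Rightarrow> nat \<Rightarrow> nat list set" where
  "B_set p ks l = {js. length js = l \<and> bounded_upto p ks js (l - 1) \<and>
                       q_idx p ks js (l - 1) + 2 - int (ks ! (l - 1)) \<le> int (js ! (l - 1)) \<and>
                       int (js ! (l - 1)) \<le> q_idx p ks js (l - 1)}"

definition C_set :: "nat \<Rightarrow> nat list \<Rightarrow> nat list set" where
  "C_set p ks = {js. length js = length ks + 1 \<and> bounded_upto p ks js (length ks) \<and>
                     int (js ! length ks) \<le> q_idx p ks js (length ks)}"

lemma q_idx_0: "q_idx p ks js 0 = int p"
  by (simp add: q_idx_def)

lemma q_idx_Suc:
  assumes "i < length ks" "i < length js"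
  shows "q_idx p ks js (Suc i) = q_idx p ks js i + 1 - int (ks ! i) - int (js ! i)"
  using assms by (simp add: q_idx_def take_Suc_conv_app_nth)

text \<open>All \<open>q\<^sub>h\<close> in denominators are nonnegative, and \<open>- q\<^sub>l \<ge> 1\<close> on the second kind of index set.\<close>

lemma q_idx_nonneg:
  assumes "bounded_upto p ks js m" "m \<le> length ks" "m \<le> length js" "h \<le> m"
  shows "q_idx p ks js h \<ge> 0"
proof (cases h)
  case 0
  then show ?thesis
    by (simp add: q_idx_0)
next
  case (Suc i)
  then have "int (js ! i) \<le> q_idx p ks js i + 1 - int (ks ! i)"
    using assms unfolding bounded_upto_def by (auto dest: bspec[where x = "Suc i"])
  then show ?thesis
    using Suc assms by (simp add: q_idx_Suc)
qed

lemma q_idx_neg: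
  assumes "js \<in> B_set p ks l" "1 \<le> l" "l \<le> length ks"
  shows "- q_idx p ks js l \<ge> 1"
  using assms q_idx_Suc[of "l - 1" ks js p] by (auto simp: B_set_def)

lemma sum_list_le_if_bounded:
  assumes "bounded_upto p ks js m" "m \<le> length ks" "length js = Suc m"
    "int (js ! m) \<le> q_idx p ks js m"
  shows "sum_list js \<le> p + m"
proof -
  have "js = take m js @ [js ! m]"
    using assms(3) by (metis lessI order_refl take_Suc_conv_app_nth take_all)
  then have "sum_list js = sum_list (take m js) + js ! m"
    by (metis sum_list.Cons sum_list.Nil sum_list_append add_0_right)
  then show ?thesis
    using assms(4) by (simp add: q_idx_def)
qed

lemma finite_bounded_lists: "finite {js :: nat list. length js = m \<and> sum_list js \<le> b}"
proof (rule finite_subset)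
  show "{js. length js = m \<and> sum_list js \<le> b} \<subseteq> {js. set js \<subseteq> {..b} \<and> length js = m}"
    by (auto intro: order_trans[OF member_le_sum_list])
qed (simp add: finite_lists_length_eq)

lemma finite_C_set: "finite (C_set p ks)"
  by (rule finite_subset[OF _ finite_bounded_lists[of "length ks + 1" "p + length ks"]])
     (auto simp: C_set_def intro: sum_list_le_if_bounded)

lemma finite_A_set:
  assumes "1 \<le> l" "l \<le> length ks"
  shows "finite (A_set p ks l)"
proof -
  obtain m where "l = Suc m"
    using assms(1) by (cases l) auto
  then show ?thesis
    using assms
    by (intro finite_subset[OF _ finite_bounded_lists[of l "p + m"]])
       (auto simp: A_set_def intro: sum_list_le_if_bounded)
qed

lemma finite_B_set:
  assumes "1 \<le> l" "l \<le> length ks"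
  shows "finite (B_set p ks l)"
  using finite_A_set[OF assms] by (rule rev_finite_subset) (auto simp: A_set_def B_set_def)

end

theory Submission
  imports Defs
begin

text \<open>
  Summation by parts moves the power sum \<open>1\<^sup>p + \<dots> + m\<^sup>p\<close> onto the entry \<open>k\<^sub>1\<close>. Faulhaber's formula
  expands it in powers of \<open>m\<close>, so that \<open>H\<^sub>n(-p, k\<^sub>1, \<dots>, k\<^sub>r)\<close> becomes the power sum times
  \<open>H\<^sub>n(k\<^sub>1, \<dots>, k\<^sub>r)\<close> minus a combination of the sums \<open>H\<^sub>n(-q, k\<^sub>2, \<dots>, k\<^sub>r)\<close> with
  \<open>q = p + 1 - k\<^sub>1 - j\<close>, \<open>0 \<le> j \<le> p\<close>. Those with \<open>q < 0\<close> are final (the sets \<open>\<B>\<^sub>l\<close>), the others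
  are expanded again by induction on \<open>r\<close>; the case \<open>r = 0\<close> is Faulhaber's formula itself.
\<close>

text \<open>Decreasing tuples and the index sets are all built by prepending a head whose value
  restricts the tail; this makes sums over them iterated sums.\<close>

lemma sum_image_Cons_Sigma:
  assumes "finite J" and "\<And>j. j \<in> J \<Longrightarrow> finite (X j)"
  shows "sum f ((\<lambda>(j, js). j # js) ` Sigma J X) = (\<Sum>j\<in>J. \<Sum>js\<in>X j. f (j # js))"
proof -
  have "inj_on (\<lambda>(j, js). j # js) (Sigma J X)"
    by (auto simp: inj_on_def)
  then show ?thesis
    using assms by (simp add: sum.reindex sum.Sigma case_prod_unfold)
qed

text \<open>The product of the two sums runs over all pairs of indices. Pairs with the
  \<open>g\<close>-index below the \<open>f\<close>-index give the left side; the rest, including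
  the diagonal, are subtracted.\<close>

lemma sum_by_parts_shifted:
  fixes f g :: "nat \<Rightarrow> 'a::comm_ring"
  shows "(\<Sum>m=1..n. f m * (\<Sum>i=1..m-1. g i)) =
    (\<Sum>m=1..n. f m) * (\<Sum>i=1..n. g i) - (\<Sum>m=1..n. g m * (\<Sum>i=1..m. f i))"
  by (induction n) (simp_all add: algebra_simps)

section \<open>Faulhaber's formula\<close>

text \<open>Since \<open>q_idx p ks js 0\<close> is \<open>p\<close>, this is also the factor for
  \<open>h = 0\<close> in \<open>c_coeff\<close>.\<close>

definition faulhaber_coeff :: "nat \<Rightarrow> nat \<Rightarrow> real" where
  "faulhaber_coeff p j = real (Suc p choose j) * bern j / real (Suc p)"

text \<open>Multiplied by \<open>fps_exp 1 - 1\<close>, both sides agree by \<open>bern_egf\<close>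
  and a geometric sum; this nonzero factor cancels.\<close>

lemma bern_egf_mult_exp:
  "Abs_fps (\<lambda>j. bern j / fact j) * (fps_exp (real n) - 1) =
    fps_X * (\<Sum>m=1..n. fps_exp (real m))"
proof -
  let ?d = "fps_exp 1 - 1 :: real fps"
  have "fps_nth ?d 1 \<noteq> 0"
    by simp
  then have nz: "?d \<noteq> 0"
    by (metis fps_zero_nth)
  have geo: "fps_exp 1 * (fps_exp (real n) - 1) = ?d * (\<Sum>m=1..n. fps_exp (real m))"
  proof (induction n)
    case (Suc n)
    then have "fps_exp 1 * (fps_exp 1 * (fps_exp (real n) - 1)) =
        fps_exp 1 * (?d * (\<Sum>m=1..n. fps_exp (real m)))"
      by (simp only:)
    then show ?case
      using Suc by (simp add: fps_exp_add_mult algebra_simps)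
  qed simp
  have "?d * (Abs_fps (\<lambda>j. bern j / fact j) * (fps_exp (real n) - 1)) =
      Abs_fps (\<lambda>j. bern j / fact j) * ?d * (fps_exp (real n) - 1)"
    by (simp only: ac_simps)
  also have "\<dots> = fps_X * (fps_exp 1 * (fps_exp (real n) - 1))"
    by (simp only: bern_egf mult.assoc)
  also have "\<dots> = ?d * (fps_X * (\<Sum>m=1..n. fps_exp (real m)))"
    by (simp only: geo ac_simps)
  finally show ?thesis
    using nz by simp
qed

text \<open>Compare the coefficients of degree \<open>Suc p\<close> in
  \<open>bern_egf_mult_exp\<close>.\<close>

lemma sum_powers_bern:
  "(\<Sum>m=1..n. real m ^ p) = (\<Sum>j\<le>p. faulhaber_coeff p j * real n ^ (Suc p - j))"
proof -
  have "(\<Sum>m=1..n. real m ^ p) / fact p =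
      fps_nth (fps_X * (\<Sum>m=1..n. fps_exp (real m))) (Suc p)"
    by (simp add: fps_sum_nth sum_divide_distrib)
  also have "\<dots> = (\<Sum>j\<le>Suc p. bern j / fact j * fps_nth (fps_exp (real n) - 1) (Suc p - j))"
    by (simp only: bern_egf_mult_exp[symmetric] fps_mult_nth atLeast0AtMost fps_nth_Abs_fps)
  \<comment> \<open>The term \<open>j = Suc p\<close> vanishes because
    \<open>fps_exp (real n) - 1\<close> has no constant term.\<close>
  also have "\<dots> = (\<Sum>j\<le>p. bern j / fact j * (real n ^ (Suc p - j) / fact (Suc p - j)))"
    by (simp add: Suc_diff_le mult_ac)
  finally have egf: "(\<Sum>m=1..n. real m ^ p) / fact p =
      (\<Sum>j\<le>p. bern j / fact j * (real n ^ (Suc p - j) / fact (Suc p - j)))" .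
  have "(\<Sum>m=1..n. real m ^ p) = fact p * ((\<Sum>m=1..n. real m ^ p) / fact p)"
    by simp
  also have "\<dots> =
      (\<Sum>j\<le>p. fact p * (bern j / fact j * (real n ^ (Suc p - j) / fact (Suc p - j))))"
    by (simp only: egf sum_distrib_left)
  also have "\<dots> = (\<Sum>j\<le>p. faulhaber_coeff p j * real n ^ (Suc p - j))"
  proof (rule sum.cong)
    fix j assume "j \<in> {..p}"
    then have "real (Suc p choose j) = fact (Suc p) / (fact j * fact (Suc p - j))"
      by (intro binomial_fact) simp
    then show "fact p * (bern j / fact j * (real n ^ (Suc p - j) / fact (Suc p - j))) =
        faulhaber_coeff p j * real n ^ (Suc p - j)"
      by (simp add: faulhaber_coeff_def mult_ac del: of_nat_Suc binomial_Suc_Suc)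
  qed simp
  finally show ?thesis .
qed

section \<open>Multiple harmonic sums\<close>

lemma decr_tuples_Suc:
  "decr_tuples n (Suc r) = (\<lambda>(m, ns). m # ns) ` (SIGMA m:{1..n}. decr_tuples (m - 1) r)"
proof (rule set_eqI)
  fix ns
  show "ns \<in> decr_tuples n (Suc r) \<longleftrightarrow>
      ns \<in> (\<lambda>(m, ns). m # ns) ` (SIGMA m:{1..n}. decr_tuples (m - 1) r)"
    by (cases ns) (force simp: decr_tuples_def image_iff)+
qed

lemma mult_harm_Cons:
  "mult_harm n (k # ks) = (\<Sum>m=1..n. real m powi (- k) * mult_harm (m - 1) ks)"
  by (simp add: mult_harm_def decr_tuples_Suc sum_image_Cons_Sigma finite_decr_tuples
      prod.lessThan_Suc_shift sum_distrib_left del: prod.lessThan_Suc)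

lemma mult_harm_neg_Cons_Nil:
  "mult_harm n [- int p] = (\<Sum>j\<le>p. faulhaber_coeff p j * real n ^ (Suc p - j))"
  unfolding sum_powers_bern[symmetric] by (simp add: mult_harm_Cons mult_harm_Nil)

text \<open>One reduction step: summation by parts with \<open>g\<close> the summand of
  \<open>mult_harm n (int k # ks)\<close>. The new first entry may have either sign.\<close>

lemma mult_harm_neg_Cons_Cons:
  "mult_harm n (- int p # int k # ks) =
    (\<Sum>j\<le>p. faulhaber_coeff p j * real n ^ (Suc p - j)) * mult_harm n (int k # ks)
    - (\<Sum>j\<le>p. faulhaber_coeff p j * mult_harm n ((int k + int j - int (Suc p)) # ks))"
proof -
  define g where "g m = real m powi (- int k) * mult_harm (m - 1) ks" for m
  have "mult_harm n (- int p # int k # ks) = (\<Sum>m=1..n. real m ^ p * (\<Sum>i=1..m-1. g i))"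
    by (simp add: mult_harm_Cons g_def)
  also have "\<dots> = (\<Sum>m=1..n. real m ^ p) * mult_harm n (int k # ks)
      - (\<Sum>m=1..n. g m * (\<Sum>i=1..m. real i ^ p))"
    unfolding sum_by_parts_shifted by (simp add: mult_harm_Cons g_def)
  also have "(\<Sum>m=1..n. g m * (\<Sum>i=1..m. real i ^ p)) =
      (\<Sum>m=1..n. \<Sum>j\<le>p. faulhaber_coeff p j * (real m ^ (Suc p - j) * g m))"
    by (simp only: sum_powers_bern sum_distrib_left ac_simps)
  also have "\<dots> = (\<Sum>j\<le>p. faulhaber_coeff p j * (\<Sum>m=1..n. real m ^ (Suc p - j) * g m))"
    by (subst sum.swap) (simp only: sum_distrib_left)
  also have "\<dots> = (\<Sum>j\<le>p. faulhaber_coeff p j * mult_harm n ((int k + int j - int (Suc p)) # ks))"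
  proof (intro sum.cong refl arg_cong2[where f = "(*)"])
    fix j assume j: "j \<in> {..p}"
    \<comment> \<open>Exponents of either sign may be added because the base is nonzero.\<close>
    have "real m ^ (Suc p - j) * real m powi (- int k) =
        real m powi (- (int k + int j - int (Suc p)))" if "m \<ge> 1" for m
      using that j
      by (simp add: power_int_add[symmetric] power_int_of_nat[symmetric] of_nat_diff algebra_simps
          del: power_int_of_nat)
    then show "(\<Sum>m=1..n. real m ^ (Suc p - j) * g m) =
        mult_harm n ((int k + int j - int (Suc p)) # ks)"
      by (simp add: mult_harm_Cons g_def mult.assoc[symmetric])
  qed
  finally show ?thesis
    by (simp only: sum_powers_bern)
qed

section \<open>The index sets\<close>

text \<open>Removing the heads turns \<open>p\<close> into the value of \<open>q_idx\<close> at
  index 1. The assumption makes this value nonnegative, so the truncated subtraction is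
  exact.\<close>

lemma q_idx_Cons:
  assumes "j + k \<le> Suc p"
  shows "q_idx p (k # ks) (j # js) (Suc i) = q_idx (Suc p - j - k) ks js i"
  using assms by (simp add: q_idx_def of_nat_diff)

lemma c_coeff_Cons:
  assumes "j + k \<le> Suc p"
  shows "c_coeff p (k # ks) (j # js) = faulhaber_coeff p j * c_coeff (Suc p - j - k) ks js"
  using assms
  by (simp add: c_coeff_def prod.lessThan_Suc_shift q_idx_Cons q_idx_0 faulhaber_coeff_def
      binomial_gbinomial add.commute del: prod.lessThan_Suc)

lemma c_coeff_singleton: "c_coeff p ks [j] = faulhaber_coeff p j"
  by (simp add: c_coeff_def q_idx_0 faulhaber_coeff_def binomial_gbinomial add.commute)

lemma bounded_upto_iff:
  "bounded_upto p ks js m \<longleftrightarrow> (\<forall>i<m. int (js ! i) \<le> q_idx p ks js i + 1 - int (ks ! i))"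
  unfolding bounded_upto_def image_Suc_lessThan[symmetric] by (simp del: image_Suc_lessThan) auto

lemma bounded_upto_0: "bounded_upto p ks js 0"
  by (simp add: bounded_upto_def)

lemma bounded_upto_Cons:
  "bounded_upto p (k # ks) (j # js) (Suc m) \<longleftrightarrow>
    j + k \<le> Suc p \<and> bounded_upto (Suc p - j - k) ks js m"
  by (auto simp: bounded_upto_iff All_less_Suc2 q_idx_0 q_idx_Cons)

lemma A_set_Suc_0: "A_set p ks (Suc 0) = (\<lambda>j. [j]) ` {..p}"
  by (auto simp: A_set_def bounded_upto_0 q_idx_0 length_Suc_conv)

text \<open>The lower bound on \<open>j\<close> is written as a negation to show the complement,
  within \<open>{..p}\<close>, of the condition under which the recursion continues.\<close>

lemma B_set_Suc_0: "B_set p (k # ks) (Suc 0) = (\<lambda>j. [j]) ` {j. j \<le> p \<and> \<not> j + k \<le> Suc p}"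
  by (auto simp: B_set_def bounded_upto_0 q_idx_0 length_Suc_conv)

lemma C_set_Nil: "C_set p [] = (\<lambda>j. [j]) ` {..p}"
  by (auto simp: C_set_def bounded_upto_0 q_idx_0 length_Suc_conv)

text \<open>In a tuple of length at least 2 the head obeys the bound involving \<open>k\<close>, and
  the tail is a tuple of the same kind for the new \<open>p\<close>. The same holds for the other
  two families.\<close>

lemma A_set_Cons:
  "A_set p (k # ks) (Suc (Suc l)) =
    (\<lambda>(j, js). j # js) ` (SIGMA j:{j. j + k \<le> Suc p}. A_set (Suc p - j - k) ks (Suc l))"
proof (rule set_eqI)
  fix js
  show "js \<in> A_set p (k # ks) (Suc (Suc l)) \<longleftrightarrow> js \<in> (\<lambda>(j, js). j # js) `
      (SIGMA j:{j. j + k \<le> Suc p}. A_set (Suc p - j - k) ks (Suc l))"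
    by (cases js) (auto simp: A_set_def bounded_upto_Cons q_idx_Cons image_iff)
qed

lemma B_set_Cons:
  "B_set p (k # ks) (Suc (Suc l)) =
    (\<lambda>(j, js). j # js) ` (SIGMA j:{j. j + k \<le> Suc p}. B_set (Suc p - j - k) ks (Suc l))"
proof (rule set_eqI)
  fix js
  show "js \<in> B_set p (k # ks) (Suc (Suc l)) \<longleftrightarrow> js \<in> (\<lambda>(j, js). j # js) `
      (SIGMA j:{j. j + k \<le> Suc p}. B_set (Suc p - j - k) ks (Suc l))"
    by (cases js) (auto simp: B_set_def bounded_upto_Cons q_idx_Cons image_iff)
qed

lemma C_set_Cons:
  "C_set p (k # ks) =
    (\<lambda>(j, js). j # js) ` (SIGMA j:{j. j + k \<le> Suc p}. C_set (Suc p - j - k) ks)"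
proof (rule set_eqI)
  fix js
  show "js \<in> C_set p (k # ks) \<longleftrightarrow> js \<in> (\<lambda>(j, js). j # js) `
      (SIGMA j:{j. j + k \<le> Suc p}. C_set (Suc p - j - k) ks)"
    by (cases js) (auto simp: C_set_def bounded_upto_Cons q_idx_Cons image_iff)
qed

lemma finite_add_le: "finite {j :: nat. j + k \<le> b}"
  by (rule finite_subset[of _ "{..b}"]) auto

section \<open>The recursion\<close>

text \<open>Here and in \<open>B_sum\<close>, \<open>l\<close> counts from 0, so the inner sum of
  the theorem for an index \<open>l\<close> is found at \<open>l - 1\<close>.\<close>

definition A_sum :: "nat \<Rightarrow> nat \<Rightarrow> nat list \<Rightarrow> nat \<Rightarrow> real" where
  "A_sum n p ks l = (\<Sum>js\<in>A_set p ks (Suc l). c_coeff p ks js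
     * real n powi (q_idx p ks js l + 1 - int (js ! l)) * mult_harm n (map int (drop l ks)))"

definition B_sum :: "nat \<Rightarrow> nat \<Rightarrow> nat list \<Rightarrow> nat \<Rightarrow> real" where
  "B_sum n p ks l = (\<Sum>js\<in>B_set p ks (Suc l). c_coeff p ks js
     * mult_harm n (- q_idx p ks js (Suc l) # map int (drop (Suc l) ks)))"

definition C_sum :: "nat \<Rightarrow> nat \<Rightarrow> nat list \<Rightarrow> real" where
  "C_sum n p ks = (\<Sum>js\<in>C_set p ks. c_coeff p ks js
     * real n powi (q_idx p ks js (length ks) + 1 - int (js ! length ks)))"

definition mult_harm_expansion :: "nat \<Rightarrow> nat \<Rightarrow> nat list \<Rightarrow> real" where
  "mult_harm_expansion n p ks =
     (\<Sum>l<length ks. (-1) ^ l * A_sum n p ks l) + (\<Sum>l<length ks. (-1) ^ Suc l * B_sum n p ks l)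
     + (-1) ^ length ks * C_sum n p ks"

lemma powi_Suc_minus:
  assumes "j \<le> p"
  shows "x powi (int p + 1 - int j) = x ^ (Suc p - j)"
proof -
  have "int p + 1 - int j = int (Suc p - j)"
    using assms by simp
  then show ?thesis
    by (simp only: power_int_of_nat)
qed

lemma A_sum_0:
  "A_sum n p ks 0 =
    (\<Sum>j\<le>p. faulhaber_coeff p j * real n ^ (Suc p - j)) * mult_harm n (map int ks)"
  by (simp add: A_sum_def A_set_Suc_0 sum.reindex inj_on_def c_coeff_singleton q_idx_0
      powi_Suc_minus sum_distrib_right)

lemma B_sum_0:
  "B_sum n p (k # ks) 0 = (\<Sum>j | j \<le> p \<and> \<not> j + k \<le> Suc p.
    faulhaber_coeff p j * mult_harm n ((int k + int j - int (Suc p)) # map int ks))"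
  by (simp add: B_sum_def B_set_Suc_0 sum.reindex inj_on_def c_coeff_singleton q_idx_def
      algebra_simps)

lemma C_sum_Nil:
  "C_sum n p [] = (\<Sum>j\<le>p. faulhaber_coeff p j * real n ^ (Suc p - j))"
  by (simp add: C_sum_def C_set_Nil sum.reindex inj_on_def c_coeff_singleton q_idx_0
      powi_Suc_minus)

lemma A_sum_Suc:
  assumes "l < length ks"
  shows "A_sum n p (k # ks) (Suc l) =
    (\<Sum>j | j + k \<le> Suc p. faulhaber_coeff p j * A_sum n (Suc p - j - k) ks l)"
  using assms
  by (simp add: A_sum_def A_set_Cons sum_image_Cons_Sigma finite_add_le finite_A_set
      c_coeff_Cons q_idx_Cons sum_distrib_left mult.assoc)

lemma B_sum_Suc:
  assumes "l < length ks"
  shows "B_sum n p (k # ks) (Suc l) =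
    (\<Sum>j | j + k \<le> Suc p. faulhaber_coeff p j * B_sum n (Suc p - j - k) ks l)"
  using assms
  by (simp add: B_sum_def B_set_Cons sum_image_Cons_Sigma finite_add_le finite_B_set
      c_coeff_Cons q_idx_Cons sum_distrib_left mult.assoc)

lemma C_sum_Cons:
  "C_sum n p (k # ks) =
    (\<Sum>j | j + k \<le> Suc p. faulhaber_coeff p j * C_sum n (Suc p - j - k) ks)"
  by (simp add: C_sum_def C_set_Cons sum_image_Cons_Sigma finite_add_le finite_C_set
      c_coeff_Cons q_idx_Cons sum_distrib_left mult.assoc)

text \<open>The expansion obeys the recursion of the harmonic sums: the terms \<open>l = 0\<close>
  split off, and lowering \<open>l\<close> or the length by one in the others yields the common
  minus sign.\<close>

lemma mult_harm_expansion_Cons: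
  "mult_harm_expansion n p (k # ks) = A_sum n p (k # ks) 0 - B_sum n p (k # ks) 0
    - (\<Sum>j | j + k \<le> Suc p. faulhaber_coeff p j * mult_harm_expansion n (Suc p - j - k) ks)"
proof -
  let ?J = "{j. j + k \<le> Suc p}"
  \<comment> \<open>The range of \<open>j\<close> does not depend on \<open>l\<close>, so the two
    sums may be exchanged.\<close>
  have swap: "(\<Sum>l<length ks. e l * (\<Sum>j\<in>?J. faulhaber_coeff p j * X j l)) =
      (\<Sum>j\<in>?J. faulhaber_coeff p j * (\<Sum>l<length ks. e l * X j l))"
    for e :: "nat \<Rightarrow> real" and X
    by (simp only: sum_distrib_left, subst sum.swap) (simp only: ac_simps)
  have A: "(\<Sum>l<length (k # ks). (-1) ^ l * A_sum n p (k # ks) l) = A_sum n p (k # ks) 0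
      - (\<Sum>j\<in>?J. faulhaber_coeff p j *
          (\<Sum>l<length ks. (-1) ^ l * A_sum n (Suc p - j - k) ks l))"
    by (simp add: sum.lessThan_Suc_shift A_sum_Suc sum_negf swap del: sum.lessThan_Suc)
  have B: "(\<Sum>l<length (k # ks). (-1) ^ Suc l * B_sum n p (k # ks) l) = - B_sum n p (k # ks) 0
      - (\<Sum>j\<in>?J. faulhaber_coeff p j *
          (\<Sum>l<length ks. (-1) ^ Suc l * B_sum n (Suc p - j - k) ks l))"
    by (simp add: sum.lessThan_Suc_shift B_sum_Suc sum_negf swap del: sum.lessThan_Suc)
  have C: "(-1) ^ length (k # ks) * C_sum n p (k # ks) =
      - (\<Sum>j\<in>?J. faulhaber_coeff p j * ((-1) ^ length ks * C_sum n (Suc p - j - k) ks))"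
    by (simp add: C_sum_Cons sum_distrib_left sum_negf mult.left_commute)
  show ?thesis
    unfolding mult_harm_expansion_def A B C
    by (simp add: distrib_left sum.distrib)
qed

text \<open>The induction leaves \<open>p\<close> arbitrary, as each \<open>j\<close> calls the
  hypothesis at its own value \<open>Suc p - j - k\<close>.\<close>

lemma mult_harm_eq_expansion:
  assumes "\<forall>k\<in>set ks. k \<ge> 1"
  shows "mult_harm n (- int p # map int ks) = mult_harm_expansion n p ks"
  using assms
proof (induction ks arbitrary: p)
  case Nil
  then show ?case
    by (simp add: mult_harm_expansion_def C_sum_Nil mult_harm_neg_Cons_Nil)
next
  case (Cons k ks)
  let ?f = "\<lambda>j. faulhaber_coeff p j * mult_harm n ((int k + int j - int (Suc p)) # map int ks)"
  have "k \<ge> 1"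
    using Cons.prems by simp
  \<comment> \<open>By \<open>k \<ge> 1\<close>, the condition \<open>j + k \<le> Suc p\<close>
    already forces \<open>j \<le> p\<close>.\<close>
  then have "{..p} = {j. j \<le> p \<and> \<not> j + k \<le> Suc p} \<union> {j. j + k \<le> Suc p}"
    by auto
  then have "(\<Sum>j\<le>p. ?f j) = (\<Sum>j | j \<le> p \<and> \<not> j + k \<le> Suc p. ?f j) + (\<Sum>j | j + k \<le> Suc p. ?f j)"
    by (simp only:) (rule sum.union_disjoint; auto simp: finite_add_le)
  also have "(\<Sum>j | j + k \<le> Suc p. ?f j) =
      (\<Sum>j | j + k \<le> Suc p. faulhaber_coeff p j * mult_harm_expansion n (Suc p - j - k) ks)"
  proof (rule sum.cong)
    fix j assume "j \<in> {j. j + k \<le> Suc p}"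
    then have "int k + int j - int (Suc p) = - int (Suc p - j - k)"
      by (simp add: of_nat_diff)
    moreover have "mult_harm n (- int (Suc p - j - k) # map int ks) =
        mult_harm_expansion n (Suc p - j - k) ks"
      using Cons.prems by (intro Cons.IH) simp
    ultimately show "?f j = faulhaber_coeff p j * mult_harm_expansion n (Suc p - j - k) ks"
      by (simp only:)
  qed simp
  finally show ?case
    by (simp add: mult_harm_expansion_Cons A_sum_0 B_sum_0 mult_harm_neg_Cons_Cons)
qed

theorem theorem2p1:
  fixes p r n :: nat and ks :: "nat list"
  assumes "r \<ge> 1" and "length ks = r" and "\<forall>k\<in>set ks. k \<ge> 1" and "n \<ge> 1"
  shows "mult_harm n (- int p # map int ks) =
      (\<Sum>l=1..r. (-1) ^ (l - 1) *
         (\<Sum>js\<in>A_set p ks l. c_coeff p ks js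
            * real n powi (q_idx p ks js (l - 1) + 1 - int (js ! (l - 1)))
            * mult_harm n (map int (drop (l - 1) ks))))
    + (\<Sum>l=1..r. (-1) ^ l *
         (\<Sum>js\<in>B_set p ks l. c_coeff p ks js
            * mult_harm n (- q_idx p ks js l # map int (drop l ks))))
    + (-1) ^ r *
         (\<Sum>js\<in>C_set p ks. c_coeff p ks js
            * real n powi (q_idx p ks js r + 1 - int (js ! r)))"
  unfolding mult_harm_eq_expansion[OF assms(3)] mult_harm_expansion_def A_sum_def B_sum_def
    C_sum_def assms(2)
  \<comment> \<open>Only the shift of \<open>l\<close> from \<open>1..r\<close> to
    \<open>l < r\<close> remains.\<close>
  by (simp add: sum.atLeast1_atMost_eq)

end
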